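(* Let $\lambda$ be a nonzero real number and let $Y$ be the Poisson random variable with parameter $\alpha>0$, i.e. $P\{Y=i\}=e^{-\alpha}\frac{\alpha^i}{i!}$ for $i=0,1,2,\dots$. Then, for all integers $n\ge k\ge 0$, $$S_{2}^{Y}(n,k)=\sum_{j=k}^{n}\alpha^{j}S_{2}(j,k)S_{2}(n,j),\qquad S_{1}^{Y}(n,k)=\sum_{j=k}^{n}\frac{1}{\alpha^{j}}S_{1}(j,k)S_{1}(n,j),$$ $$S_{2,\lambda}^{Y}(n,k)=\sum_{j=k}^{n}\alpha^{j}S_{2}(j,k)S_{2,\lambda}(n,j),\qquad S_{1,\lambda}^{Y}(n,k)=\sum_{j=k}^{n}\frac{1}{\alpha^{j}}S_{1,\lambda}(j,k)S_{1}(n,j).$$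
   Context: Classical notions. $S_2(n,k)$ and $S_1(n,k)$ are the Stirling numbers of the second kind and the (signed) Stirling numbers of the first kind: $\frac{1}{k!}(e^t-1)^k=\sum_{n\ge k}S_2(n,k)\frac{t^n}{n!}$, $\frac{1}{k!}(\log(1+t))^k=\sum_{n\ge k}S_1(n,k)\frac{t^n}{n!}$. For nonzero real $\lambda$: $(x)_{0,\lambda}=1$, $(x)_{n,\lambda}=x(x-\lambda)\cdots(x-(n-1)\lambda)$; $e_\lambda^x(t)=(1+\lambda t)^{x/\lambda}=\sum_{n\ge0}(x)_{n,\lambda}\frac{t^n}{n!}$, $e_\lambda(t)=e_\lambda^1(t)$; $\log_\lambda(t)=\frac1\lambda(t^\lambda-1)$. The degenerate Stirling numbers of the second and first kind are defined by $\frac{1}{k!}(e_\lambda(t)-1)^k=\sum_{n\ge k}S_{2,\lambda}(n,k)\frac{t^n}{n!}$ and $\frac{1}{k!}(\log_\lambda(1+t))^k=\sum_{n\ge k}S_{1,\lambda}(n,k)\frac{t^n}{n!}$. Probabilistic versions. For a random variable $Y$ whose moment generating function exists near $0$ and with $E[Y]\ne0$, put $e_Y(t)=E[e^{Yt}]-1=\sum_{n\ge1}E[Y^n]\frac{t^n}{n!}$ and $e_{Y,\lambda}(t)=E[e_\lambda^Y(t)]-1=\sum_{n\ge1}E[(Y)_{n,\lambda}]\frac{t^n}{n!}$ (power series in $t$), and let $\bar e_Y(t)$, $\bar e_{Y,\lambda}(t)$ be their compositional inverses. Then for $k\ge0$: $\frac{1}{k!}(e_Y(t))^k=\sum_{n\ge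 k}S_2^Y(n,k)\frac{t^n}{n!}$, $\frac{1}{k!}(\bar e_Y(t))^k=\sum_{n\ge k}S_1^Y(n,k)\frac{t^n}{n!}$, $\frac{1}{k!}(e_{Y,\lambda}(t))^k=\sum_{n\ge k}S_{2,\lambda}^Y(n,k)\frac{t^n}{n!}$, $\frac{1}{k!}(\bar e_{Y,\lambda}(t))^k=\sum_{n\ge k}S_{1,\lambda}^Y(n,k)\frac{t^n}{n!}$ define the probabilistic (degenerate) Stirling numbers associated with $Y$. *)

theory Defs
  imports
    "HOL-Probability.Probability"
    "HOL-Combinatorics.Stirling"
    "HOL-Computational_Algebra.Formal_Power_Series"
begin

text \<open>All generating functions are formal power series over the reals.  The coefficient array
  \<open>T\<close> determined by \<open>f(t)\<^sup>k / k! = (\<Sum>n\<ge>k. T(n,k) t\<^sup>n / n!)\<close> for a series \<open>f\<close> without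
  constant term:\<close>

definition egf_array :: "real fps \<Rightarrow> nat \<Rightarrow> nat \<Rightarrow> real" where
  "egf_array f n k = fact n * fps_nth (fps_const (1 / fact k) * f ^ k) n"

lemma egf_array_sum:
  "fps_const (1 / fact k) * f ^ k = Abs_fps (\<lambda>n. egf_array f n k / fact n)"
  by (simp add: egf_array_def fps_eq_iff)

lemma egf_array_less:
  assumes "fps_nth f 0 = 0" "n < k"
  shows "egf_array f n k = 0"
  using assms by (simp add: egf_array_def startsby_zero_power_prefix)


lemma fps_deriv_divided_power:
  "fps_deriv (fps_const (1 / fact (Suc k)) * f ^ Suc k)
    = fps_const (1 / fact k) * f ^ k * fps_deriv (f :: real fps)"
proof -
  have "fps_deriv (f ^ Suc k) = fps_const (real (Suc k)) * fps_deriv f * f ^ k"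
    using fps_deriv_power[of f "Suc k"] by simp
  moreover have "fps_const (1 / fact (Suc k)) * fps_const (real (Suc k)) = fps_const (1 / fact k)"
    by (simp del: of_nat_Suc)
  ultimately show ?thesis
    by (metis (no_types, lifting) fps_deriv_mult_const_left mult.assoc mult.commute)
qed

text \<open>Stirling numbers of the second kind are the library's \<^const>\<open>Stirling\<close>; the recursion
  used there yields the generating function definition:\<close>

lemma Stirling_egf: "real (Stirling n k) = egf_array (fps_exp 1 - 1) n k"
proof (induction n k rule: Stirling.induct)
  case (4 n k)
  let ?f = "fps_exp (1::real) - 1"
  have c: "fps_const (1 / fact k) = fps_const (real (Suc k)) * fps_const (1 / fact (Suc k))"
    by (simp del: of_nat_Suc)
  have "c * F ^ k * (F + 1) = b * (a * F ^ Suc k) + c * F ^ k" if "c = b * a" for a b c F :: "real fps"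
    using that by (simp add: algebra_simps)
  from this[OF c, of ?f] have d: "fps_deriv (fps_const (1 / fact (Suc k)) * ?f ^ Suc k)
      = fps_const (real (Suc k)) * (fps_const (1 / fact (Suc k)) * ?f ^ Suc k)
        + fps_const (1 / fact k) * ?f ^ k"
    unfolding fps_deriv_divided_power by simp
  have "egf_array ?f (Suc n) (Suc k)
      = fact n * fps_nth (fps_deriv (fps_const (1 / fact (Suc k)) * ?f ^ Suc k)) n"
    unfolding egf_array_def by (simp only: fps_deriv_nth) (simp add: algebra_simps)
  also have "\<dots> = of_nat (Suc k) * egf_array ?f n (Suc k) + egf_array ?f n k"
    unfolding d egf_array_def
    by (simp only: fps_add_nth fps_of_nat [symmetric] fps_mult_left_const_nth) (simp add: algebra_simps)
  finally show ?case
    using 4 by (simp add: algebra_simps)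
qed (simp_all add: egf_array_def)


text \<open>The library's \<^const>\<open>stirling\<close> is unsigned; the signed numbers of the first kind are the
  coefficients of the powers of \<open>log(1+t)\<close>, which is \<^term>\<open>fps_ln 1\<close>.\<close>

definition stirling1 :: "nat \<Rightarrow> nat \<Rightarrow> real" where
  "stirling1 = egf_array (fps_ln 1)"

lemma stirling1_stirling: "stirling1 n k = (- 1) ^ (n + k) * real (stirling n k)"
proof (induction n k rule: stirling.induct)
  case (4 n k)
  let ?f = "fps_ln (1::real)"
  let ?g = "fps_const (1 / fact (Suc k)) * ?f ^ Suc k"
  have "fps_deriv ?g = fps_const (1 / fact k) * ?f ^ k * inverse (1 + fps_X)"
    unfolding fps_deriv_divided_power by (simp add: fps_ln_deriv)
  moreover have "inverse (1 + fps_X) * (1 + fps_X) = (1 :: real fps)"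
    by (rule inverse_mult_eq_1) simp
  ultimately have d: "(1 + fps_X) * fps_deriv ?g = fps_const (1 / fact k) * ?f ^ k"
    by (simp add: mult.commute mult.left_commute)
  have "fact n * fps_nth ((1 + fps_X) * fps_deriv g) n
      = fact (Suc n) * fps_nth g (Suc n) + real n * (fact n * fps_nth g n)" for g :: "real fps"
    by (cases n) (simp_all add: distrib_right algebra_simps)
  from this[of ?g] have "fact n * fps_nth ((1 + fps_X) * fps_deriv ?g) n
      = stirling1 (Suc n) (Suc k) + real n * stirling1 n (Suc k)"
    unfolding stirling1_def egf_array_def .
  then have "stirling1 (Suc n) (Suc k) = stirling1 n k - real n * stirling1 n (Suc k)"
    unfolding d by (simp add: stirling1_def egf_array_def)
  then show ?case
    using 4 by (simp add: algebra_simps)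
qed (simp_all add: stirling1_def egf_array_def)


text \<open>Degenerate falling factorials, the degenerate exponential \<open>(1 + \<lambda>t)\<close> to the power \<open>x/\<lambda>\<close>,
  and the degenerate logarithm at \<open>1 + t\<close>, that is \<open>((1 + t)\<^sup>\<lambda> - 1) / \<lambda>\<close>.\<close>

definition degen_ffact :: "real \<Rightarrow> real \<Rightarrow> nat \<Rightarrow> real" where
  "degen_ffact l x n = (\<Prod>i<n. x - real i * l)"

definition degen_exp :: "real \<Rightarrow> real \<Rightarrow> real fps" where
  "degen_exp l x = Abs_fps (\<lambda>n. degen_ffact l x n / fact n)"

lemma degen_exp_binomial:
  assumes "l \<noteq> 0"
  shows "degen_exp l x = fps_binomial (x / l) oo (fps_const l * fps_X)"
proof -
  have "degen_ffact l x n = l ^ n * (\<Prod>i<n. x / l - real i)" for n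
    using assms by (induction n) (simp_all add: degen_ffact_def field_simps)
  then show ?thesis
    by (simp add: fps_eq_iff degen_exp_def fps_compose_linear gbinomial_prod_rev
        atLeast0LessThan)
qed

definition degen_ln1p :: "real \<Rightarrow> real fps" where
  "degen_ln1p l = fps_const (1 / l) * (fps_binomial l - 1)"

definition degen_stirling2 :: "real \<Rightarrow> nat \<Rightarrow> nat \<Rightarrow> real" where
  "degen_stirling2 l = egf_array (degen_exp l 1 - 1)"

definition degen_stirling1 :: "real \<Rightarrow> nat \<Rightarrow> nat \<Rightarrow> real" where
  "degen_stirling1 l = egf_array (degen_ln1p l)"


text \<open>The expectation of a random power series is taken coefficientwise.  It is meaningful only if
  the coefficients are integrable: the Bochner integral of a non-integrable function is \<open>0\<close>.\<close>

definition expectation_fps :: "'a measure \<Rightarrow> ('a \<Rightarrow> real fps) \<Rightarrow> real fps" where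
  "expectation_fps M F = Abs_fps (\<lambda>n. \<integral>\<omega>. fps_nth (F \<omega>) n \<partial>M)"

definition prob_exp :: "'a measure \<Rightarrow> ('a \<Rightarrow> real) \<Rightarrow> real fps" where
  "prob_exp M Y = expectation_fps M (\<lambda>\<omega>. fps_exp (Y \<omega>)) - 1"

definition prob_degen_exp :: "'a measure \<Rightarrow> real \<Rightarrow> ('a \<Rightarrow> real) \<Rightarrow> real fps" where
  "prob_degen_exp M l Y = expectation_fps M (\<lambda>\<omega>. degen_exp l (Y \<omega>)) - 1"

lemma (in prob_space) prob_exp_moments:
  "prob_exp M Y = Abs_fps (\<lambda>n. if n = 0 then 0 else expectation (\<lambda>\<omega>. Y \<omega> ^ n) / fact n)"
  by (simp add: prob_exp_def expectation_fps_def fps_eq_iff prob_space)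

lemma (in prob_space) prob_degen_exp_moments:
  "prob_degen_exp M l Y =
    Abs_fps (\<lambda>n. if n = 0 then 0 else expectation (\<lambda>\<omega>. degen_ffact l (Y \<omega>) n) / fact n)"
  by (simp add: prob_degen_exp_def expectation_fps_def degen_exp_def degen_ffact_def fps_eq_iff
      prob_space)

text \<open>The library's \<^const>\<open>fps_inv\<close> is the compositional inverse of a series with zero constant
  term and nonzero linear coefficient; for the two series above the latter is the mean of \<open>Y\<close>.\<close>

definition prob_stirling2 :: "'a measure \<Rightarrow> ('a \<Rightarrow> real) \<Rightarrow> nat \<Rightarrow> nat \<Rightarrow> real" where
  "prob_stirling2 M Y = egf_array (prob_exp M Y)"

definition prob_stirling1 :: "'a measure \<Rightarrow> ('a \<Rightarrow> real) \<Rightarrow> nat \<Rightarrow> nat \<Rightarrow> real" where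
  "prob_stirling1 M Y = egf_array (fps_inv (prob_exp M Y))"

definition prob_degen_stirling2 :: "'a measure \<Rightarrow> real \<Rightarrow> ('a \<Rightarrow> real) \<Rightarrow> nat \<Rightarrow> nat \<Rightarrow> real" where
  "prob_degen_stirling2 M l Y = egf_array (prob_degen_exp M l Y)"

definition prob_degen_stirling1 :: "'a measure \<Rightarrow> real \<Rightarrow> ('a \<Rightarrow> real) \<Rightarrow> nat \<Rightarrow> nat \<Rightarrow> real" where
  "prob_degen_stirling1 M l Y = egf_array (fps_inv (prob_degen_exp M l Y))"

end

theory Submission
  imports Defs
begin

text \<open>
  Write \<open>e(t) = exp(t) - 1\<close> and let \<open>g\<close> be either \<open>e\<close> or the degenerate series
  \<open>e\<^sub>\<lambda>(t) - 1\<close>.  For a natural number \<open>i\<close> the (degenerate) exponential with exponent \<open>i\<close> is the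
  power \<open>(1 + g(t))\<^sup>i\<close>.  Hence, for a Poisson variable \<open>Y\<close>, the expected exponential is the
  probability generating function \<open>exp(\<alpha>(z - 1))\<close> at \<open>z = 1 + g(t)\<close>, and
  \<open>E[(1 + g(t))\<^sup>Y] - 1 = e(\<alpha> g(t))\<close> (\<open>expectation_fps_poisson\<close>).  At the level of formal power
  series this identity is a statement about the binomial moments
  \<open>E[Y choose j] = \<alpha>\<^sup>j / j!\<close>: each coefficient of \<open>(1 + g)\<^sup>Y\<close> is a finite linear combination of the
  \<open>Y choose j\<close>, and these moments are the coefficients of \<open>exp(\<alpha> t)\<close>.

  The arrays of divided powers turn composition of series into multiplication of triangular
  matrices; the scaling factor \<open>\<alpha>\<close> between the two series contributes the diagonal matrix with
  entries \<open>\<alpha>\<^sup>j\<close> (\<open>egf_array_compose_scaled\<close>).  Applied to \<open>e(\<alpha> g(t))\<close> this gives both formulas of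
  the second kind.  The compositional inverse of \<open>e(\<alpha> g(t))\<close> is \<open>g\<^sup>-\<^sup>1(log(1 + t) / \<alpha>)\<close>
  (\<open>fps_inv_compose_scaled\<close>), a composition of the same shape; since \<open>g\<^sup>-\<^sup>1\<close> is \<open>log(1 + t)\<close> or the
  degenerate logarithm (\<open>fps_inv_degen_exp\<close>), the formulas of the first kind follow in the same
  way.
\<close>

section \<open>Composition and inversion of power series\<close>

text \<open>The coefficient of \<open>f\<^sup>k \<circ> (c g)\<close> is a sum over \<open>j\<close> of the \<open>j\<close>-th coefficient of \<open>f\<^sup>k\<close> times a
  coefficient of \<open>c\<^sup>j g\<^sup>j\<close>; inserting \<open>j! / j!\<close> makes it a product of two arrays.\<close>

lemma egf_array_compose_scaled:
  fixes f g :: "real fps"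
  assumes "fps_nth f 0 = 0" "fps_nth g 0 = 0"
  shows "egf_array (f oo (fps_const c * g)) n k
           = (\<Sum>j=k..n. c ^ j * egf_array f j k * egf_array g n j)"
proof -
  have "egf_array (f oo (fps_const c * g)) n k
          = fact n * (1 / fact k * fps_nth (f ^ k oo (fps_const c * g)) n)"
    using assms by (simp add: egf_array_def fps_compose_power)
  also have "\<dots> = (\<Sum>j=0..n. c ^ j * egf_array f j k * egf_array g n j)"
    by (simp add: fps_compose_nth egf_array_def power_mult_distrib fps_const_power
        sum_distrib_left mult_ac)
  also have "\<dots> = (\<Sum>j=k..n. c ^ j * egf_array f j k * egf_array g n j)"
    using assms(1) by (intro sum.mono_neutral_right) (auto simp: egf_array_less)
  finally show ?thesis .
qed

lemma fps_inv_eqI: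
  fixes f h :: "real fps"
  assumes "fps_nth f 0 = 0" "fps_nth f 1 \<noteq> 0" "h oo f = fps_X"
  shows "fps_inv f = h"
  using fps_compose_inj_right[OF assms(1,2)] fps_inv[OF assms(1,2)] assms(3) by metis

text \<open>The right-hand side undoes the three steps of \<open>f(c g(t))\<close> in reverse order: first \<open>f\<close>, then
  the scaling, then \<open>g\<close>.\<close>

lemma fps_inv_compose_scaled:
  fixes f g :: "real fps"
  assumes f: "fps_nth f 0 = 0" "fps_nth f 1 \<noteq> 0"
    and g: "fps_nth g 0 = 0" "fps_nth g 1 \<noteq> 0"
    and c: "c \<noteq> 0"
  shows "fps_inv (f oo (fps_const c * g)) = fps_inv g oo (fps_const (1 / c) * fps_inv f)"
proof (rule fps_inv_eqI)
  have inv0: "fps_nth (fps_inv f) 0 = 0"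
    by (simp add: fps_inv_def)
  show "fps_nth (f oo (fps_const c * g)) 0 = 0" "fps_nth (f oo (fps_const c * g)) 1 \<noteq> 0"
    using assms by (simp_all add: fps_compose_nth)
  have "(fps_const (1 / c) * fps_inv f) oo (f oo (fps_const c * g))
      = fps_const (1 / c) * ((fps_inv f oo f) oo (fps_const c * g))"
    using f g by (simp add: fps_compose_mult_distrib fps_compose_assoc)
  also have "\<dots> = g"
    using f g c by (simp add: fps_inv mult.assoc [symmetric])
  finally show "fps_inv g oo (fps_const (1 / c) * fps_inv f) oo (f oo (fps_const c * g)) = fps_X"
    using f g inv0 by (simp add: fps_compose_assoc [symmetric] fps_inv)
qed

lemma fps_exp_compose_scaled:
  "fps_exp c oo g = fps_exp 1 oo (fps_const c * g)" for g :: "real fps"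
  by (simp add: fps_eq_iff fps_compose_nth power_mult_distrib fps_const_power)

text \<open>This is the law \<open>((1 + t)\<^sup>b)\<^sup>a = (1 + t)\<^sup>a\<^sup>b\<close>.  By the chain rule the left-hand side \<open>B\<close> satisfies
  \<open>(1 + t) B' = a b B\<close> with \<open>B(0) = 1\<close>, and the binomial series is the only solution.\<close>

lemma fps_binomial_compose:
  "fps_binomial a oo (fps_binomial b - 1) = fps_binomial (a * b)" for a b :: real
proof -
  let ?g = "fps_binomial b - 1" and ?B = "fps_binomial a oo (fps_binomial b - 1)"
  have g0: "fps_nth ?g 0 = 0"
    by simp
  have "inverse (1 + fps_X) oo ?g = inverse (fps_binomial b)"
    by (subst fps_inverse_compose[OF g0]) (simp_all add: fps_compose_add_distrib)
  then have "fps_deriv (fps_binomial a) oo ?g = fps_const a * ?B * inverse (fps_binomial b)"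
    by (simp add: fps_binomial_deriv fps_divide_unit fps_compose_mult_distrib[OF g0])
  then have "fps_deriv ?B
      = fps_const a * ?B * (inverse (fps_binomial b) * fps_binomial b) * fps_const b
          * inverse (1 + fps_X)"
    unfolding fps_compose_deriv[OF g0]
    by (simp add: fps_binomial_deriv fps_divide_unit mult_ac)
  moreover have "inverse (fps_binomial b) * fps_binomial b = 1"
    by (rule inverse_mult_eq_1) simp
  ultimately have "fps_deriv ?B = fps_const (a * b) * ?B / (1 + fps_X)"
    by (simp add: fps_divide_unit fps_const_mult [symmetric] mult_ac del: fps_const_mult)
  then show ?thesis
    using fps_binomial_ODE_unique'[of ?B "a * b"] by simp
qed

section \<open>The degenerate exponential and logarithm\<close>

lemma degen_exp_nth_0 [simp]: "fps_nth (degen_exp l x) 0 = 1"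
  and degen_exp_nth_1 [simp]: "fps_nth (degen_exp l x) (Suc 0) = x"
  by (simp_all add: degen_exp_def degen_ffact_def)

lemma degen_exp_of_nat:
  assumes "l \<noteq> 0"
  shows "degen_exp l (real i) = degen_exp l 1 ^ i"
  using assms
  by (simp add: degen_exp_binomial fps_compose_power fps_binomial_power)

text \<open>The power \<open>\<lambda>\<close> of \<open>(1 + \<lambda>t)\<close> to the \<open>1/\<lambda>\<close> is \<open>1 + \<lambda>t\<close>; the degenerate logarithm then
  subtracts \<open>1\<close> and divides by \<open>\<lambda>\<close>, which leaves \<open>t\<close>.\<close>

lemma fps_inv_degen_exp:
  assumes "l \<noteq> 0"
  shows "fps_inv (degen_exp l 1 - 1) = degen_ln1p l"
proof (rule fps_inv_eqI)
  let ?X = "fps_const l * fps_X :: real fps"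
  have "fps_binomial l oo (degen_exp l 1 - 1) = fps_binomial l oo ((fps_binomial (1 / l) - 1) oo ?X)"
    using assms by (simp add: degen_exp_binomial fps_compose_sub_distrib)
  also have "\<dots> = fps_binomial l oo (fps_binomial (1 / l) - 1) oo ?X"
    by (rule fps_compose_assoc) simp_all
  also have "\<dots> = 1 + ?X"
    using assms by (simp add: fps_binomial_compose fps_binomial_1 fps_compose_add_distrib)
  finally show "degen_ln1p l oo (degen_exp l 1 - 1) = fps_X"
    using assms unfolding degen_ln1p_def
    by (simp add: fps_compose_mult_distrib fps_compose_sub_distrib mult.assoc [symmetric])
qed simp_all

section \<open>Poisson expectations\<close>

text \<open>The terms with \<open>i < j\<close> vanish, and substituting \<open>i = m + j\<close> cancels \<open>(m + j)!\<close>, which leaves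
  \<open>\<alpha>\<^sup>j / j!\<close> times the exponential series for \<open>exp \<alpha>\<close>.\<close>

lemma sums_poisson_binomial_moment:
  fixes \<alpha> :: real
  shows "(\<lambda>i. exp (- \<alpha>) * \<alpha> ^ i / fact i * real (i choose j)) sums (\<alpha> ^ j / fact j)"
proof -
  let ?f = "\<lambda>i. exp (- \<alpha>) * \<alpha> ^ i / fact i * real (i choose j)"
  have "(\<lambda>m. \<alpha> ^ m /\<^sub>R fact m) sums exp \<alpha>"
    by (rule exp_converges)
  then have "(\<lambda>m. exp (- \<alpha>) * \<alpha> ^ j / fact j * (\<alpha> ^ m /\<^sub>R fact m))
      sums (exp (- \<alpha>) * \<alpha> ^ j / fact j * exp \<alpha>)"
    by (rule sums_mult)
  moreover have "exp (- \<alpha>) * \<alpha> ^ j / fact j * (\<alpha> ^ m /\<^sub>R fact m) = ?f (m + j)" for m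
    by (simp add: binomial_fact power_add field_simps)
  moreover have "exp (- \<alpha>) * \<alpha> ^ j / fact j * exp \<alpha> = \<alpha> ^ j / fact j"
    by (simp add: exp_minus)
  ultimately have "(\<lambda>m. ?f (m + j)) sums (\<alpha> ^ j / fact j)"
    by (simp only:)
  moreover have "?f i = 0" if "i < j" for i
    using that by simp
  ultimately show ?thesis
    using sums_zero_iff_shift[of j ?f] by blast
qed

lemma poisson_binomial_moment:
  assumes "\<alpha> > 0"
  shows "integrable (poisson_pmf \<alpha>) (\<lambda>i. real (i choose j))"
    and "measure_pmf.expectation (poisson_pmf \<alpha>) (\<lambda>i. real (i choose j)) = \<alpha> ^ j / fact j"
proof -
  have s: "(\<lambda>i. pmf (poisson_pmf \<alpha>) i * real (i choose j)) sums (\<alpha> ^ j / fact j)"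
    using sums_poisson_binomial_moment[of \<alpha> j] assms by (simp add: mult_ac)
  then have i: "integrable (count_space UNIV) (\<lambda>i. pmf (poisson_pmf \<alpha>) i * real (i choose j))"
    by (subst integrable_count_space_nat_iff) (simp add: sums_iff abs_mult)
  then show "integrable (poisson_pmf \<alpha>) (\<lambda>i. real (i choose j))"
    unfolding measure_pmf_eq_density by (subst integrable_density) auto
  show "measure_pmf.expectation (poisson_pmf \<alpha>) (\<lambda>i. real (i choose j)) = \<alpha> ^ j / fact j"
    using i s unfolding measure_pmf_eq_density
    by (subst integral_density) (auto simp: integral_count_space_nat sums_iff)
qed

text \<open>Expanding \<open>(1 + g)\<^sup>i\<close> by the binomial theorem, the \<open>n\<close>-th coefficient involves only
  \<open>g\<^sup>j\<close> with \<open>j \<le> n\<close>, because \<open>g\<close> has no constant term.  So the expectation is a finite sum of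
  binomial moments, and these are exactly the coefficients of the outer series \<open>exp(\<alpha> t)\<close>.\<close>

lemma poisson_expectation_power:
  fixes g :: "real fps"
  assumes "\<alpha> > 0" "fps_nth g 0 = 0"
  shows "measure_pmf.expectation (poisson_pmf \<alpha>) (\<lambda>i. fps_nth ((1 + g) ^ i) n)
           = fps_nth (fps_exp \<alpha> oo g) n"
proof -
  have "fps_nth ((1 + g) ^ i) n = (\<Sum>j=0..n. real (i choose j) * fps_nth (g ^ j) n)" for i
  proof -
    have "fps_nth ((1 + g) ^ i) n = fps_nth ((1 + fps_X) ^ i oo g) n"
      using assms(2) by (simp add: fps_compose_power [symmetric] fps_compose_add_distrib)
    also have "(1 + fps_X) ^ i = (fps_binomial (of_nat i) :: real fps)"
      by (rule fps_binomial_of_nat [symmetric])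
    finally show ?thesis
      by (simp add: fps_compose_nth binomial_gbinomial)
  qed
  then show ?thesis
    using assms(1)
    by (simp add: fps_compose_nth poisson_binomial_moment)
qed

text \<open>The law is prescribed only by its point masses at the natural numbers.  As these add up to
  \<open>1\<close>, the variable \<open>Y\<close> takes natural values almost surely, and its rounding \<open>N\<close> has
  distribution \<open>p\<close>.\<close>

lemma (in prob_space) expectation_nat_valued:
  fixes p :: "nat pmf" and h :: "real \<Rightarrow> real"
  assumes [measurable]: "Y \<in> borel_measurable M" "h \<in> borel_measurable borel"
    and law: "\<And>i::nat. \<P>(\<omega> in M. Y \<omega> = real i) = pmf p i"
  shows "expectation (\<lambda>\<omega>. h (Y \<omega>)) = measure_pmf.expectation p (\<lambda>i. h (real i))"
proof -
  let ?A = "\<lambda>i::nat. {\<omega> \<in> space M. Y \<omega> = real i}"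
  define N where "N \<omega> = nat \<lfloor>Y \<omega>\<rfloor>" for \<omega>
  have [measurable]: "N \<in> measurable M (count_space UNIV)"
    unfolding N_def by measurable
  have "(\<lambda>i. prob (?A i)) sums prob (\<Union>i. ?A i)"
    by (rule finite_measure_UNION) (auto simp: disjoint_family_on_def)
  moreover have "(\<lambda>i. measure (measure_pmf p) {i}) sums measure (measure_pmf p) (\<Union>i. {i})"
    by (rule measure_pmf.finite_measure_UNION) (auto simp: disjoint_family_on_def)
  then have "(\<lambda>i. pmf p i) sums 1"
    by (simp add: pmf.rep_eq measure_pmf.prob_space[simplified])
  ultimately have "prob (\<Union>i. ?A i) = 1"
    using law sums_unique2 by auto
  then have "AE \<omega> in M. \<omega> \<in> (\<Union>i. ?A i)"
    by (intro prob_eq_1[THEN iffD1]) measurable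
  then have Y_eq: "AE \<omega> in M. Y \<omega> = real (N \<omega>)"
    by eventually_elim (auto simp: N_def)
  have "distr M (count_space UNIV) N = measure_pmf p"
  proof (rule measure_eqI_countable[where A=UNIV])
    fix i
    have "emeasure (distr M (count_space UNIV) N) {i} = emeasure M {\<omega> \<in> space M. N \<omega> = i}"
      by (simp add: emeasure_distr vimage_def Int_def conj_commute)
    also have "\<dots> = emeasure M (?A i)"
      by (rule emeasure_eq_AE) (use Y_eq in \<open>auto elim!: eventually_mono\<close>)
    also have "\<dots> = emeasure (measure_pmf p) {i}"
      by (simp add: emeasure_eq_measure law emeasure_pmf_single)
    finally show "emeasure (distr M (count_space UNIV) N) {i} = emeasure (measure_pmf p) {i}" .
  qed auto
  moreover have "expectation (\<lambda>\<omega>. h (Y \<omega>)) = expectation (\<lambda>\<omega>. h (real (N \<omega>)))"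
    using Y_eq by (intro integral_cong_AE) auto
  moreover have "\<dots> = (\<integral>i. h (real i) \<partial>distr M (count_space UNIV) N)"
    by (rule integral_distr [symmetric]) auto
  ultimately show ?thesis
    by simp
qed

text \<open>The family \<open>F\<close> of series, one for each real exponent, covers the ordinary and the degenerate
  exponential at once: the exponent \<open>Y\<close> is almost surely natural, and there \<open>F\<close> is given by the
  powers of \<open>1 + g\<close>.\<close>

lemma (in prob_space) expectation_fps_poisson:
  fixes F :: "real \<Rightarrow> real fps"
  assumes "Y \<in> borel_measurable M" "\<And>n. (\<lambda>y. fps_nth (F y) n) \<in> borel_measurable borel"
    and "\<alpha> > 0"
    and "\<And>i::nat. \<P>(\<omega> in M. Y \<omega> = real i) = exp (- \<alpha>) * \<alpha> ^ i / fact i"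
    and "fps_nth g 0 = 0" "\<And>i::nat. F (real i) = (1 + g) ^ i"
  shows "expectation_fps M (\<lambda>\<omega>. F (Y \<omega>)) - 1 = (fps_exp 1 - 1) oo (fps_const \<alpha> * g)"
proof -
  have "expectation (\<lambda>\<omega>. fps_nth (F (Y \<omega>)) n) = fps_nth (fps_exp \<alpha> oo g) n" for n
  proof -
    have "expectation (\<lambda>\<omega>. fps_nth (F (Y \<omega>)) n)
        = measure_pmf.expectation (poisson_pmf \<alpha>) (\<lambda>i. fps_nth (F (real i)) n)"
      using assms(3) by (intro expectation_nat_valued assms) (simp add: assms(4))
    then show ?thesis
      using assms by (simp add: poisson_expectation_power)
  qed
  then have "expectation_fps M (\<lambda>\<omega>. F (Y \<omega>)) = fps_exp \<alpha> oo g"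
    by (simp add: expectation_fps_def fps_eq_iff)
  then show ?thesis
    by (simp add: fps_compose_sub_distrib fps_exp_compose_scaled[of \<alpha>])
qed

section \<open>Stirling numbers associated with a Poisson variable\<close>

theorem theorem2p3:
  fixes M :: "'a measure" and Y :: "'a \<Rightarrow> real" and \<alpha> l :: real and n k :: nat
  assumes "prob_space M"
    and "Y \<in> borel_measurable M"
    and "\<alpha> > 0"
    and "\<And>i::nat. \<P>(\<omega> in M. Y \<omega> = real i) = exp (- \<alpha>) * \<alpha> ^ i / fact i"
    and "l \<noteq> 0"
    and "k \<le> n"
  shows "prob_stirling2 M Y n k
           = (\<Sum>j=k..n. \<alpha> ^ j * real (Stirling j k) * real (Stirling n j))
       \<and> prob_stirling1 M Y n k
           = (\<Sum>j=k..n. 1 / \<alpha> ^ j * stirling1 j k * stirling1 n j)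
       \<and> prob_degen_stirling2 M l Y n k
           = (\<Sum>j=k..n. \<alpha> ^ j * real (Stirling j k) * degen_stirling2 l n j)
       \<and> prob_degen_stirling1 M l Y n k
           = (\<Sum>j=k..n. 1 / \<alpha> ^ j * degen_stirling1 l j k * stirling1 n j)"
proof -
  interpret prob_space M
    by fact
  let ?e = "fps_exp 1 - 1 :: real fps" and ?d = "degen_exp l 1 - 1"
  have exp: "prob_exp M Y = ?e oo (fps_const \<alpha> * ?e)"
    unfolding prob_exp_def
    by (rule expectation_fps_poisson) (use assms in \<open>simp_all add: fps_exp_power_mult\<close>)
  have degen_exp: "prob_degen_exp M l Y = ?e oo (fps_const \<alpha> * ?d)"
    unfolding prob_degen_exp_def
  proof (rule expectation_fps_poisson)
    show "(\<lambda>y. fps_nth (degen_exp l y) n) \<in> borel_measurable borel" for n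
      by (simp add: degen_exp_def degen_ffact_def)
  qed (use assms in \<open>simp_all add: degen_exp_of_nat\<close>)
  have ln: "fps_inv ?e = fps_ln 1"
    by (simp add: fps_ln_fps_exp_inv)
  have ln0: "fps_nth (degen_ln1p l) 0 = 0"
    by (simp add: degen_ln1p_def)
  have inv_exp: "fps_inv (prob_exp M Y) = fps_ln 1 oo (fps_const (1 / \<alpha>) * fps_ln 1)"
    unfolding exp using assms(3) by (simp add: fps_inv_compose_scaled ln)
  have inv_degen: "fps_inv (prob_degen_exp M l Y) = degen_ln1p l oo (fps_const (1 / \<alpha>) * fps_ln 1)"
    unfolding degen_exp using assms(3,5) by (simp add: fps_inv_compose_scaled ln fps_inv_degen_exp)
  show ?thesis
    unfolding prob_stirling2_def prob_stirling1_def prob_degen_stirling2_def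
      prob_degen_stirling1_def inv_exp inv_degen unfolding exp degen_exp
    by (simp add: egf_array_compose_scaled ln0 Stirling_egf stirling1_def degen_stirling2_def
        degen_stirling1_def power_one_over)
qed

end
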